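(* Let $z$ be any real value satisfying $z < c \cdot e$. If $x^*$ solves (i.e. is optimal for) $$(\mathrm{P}_z) \qquad \sup\ \lambda_{\min}(x) \quad \text{s.t.} \quad x \in \mathrm{Affine}_z,$$ then $\pi(x^* )$ is optimal for CP. Conversely, if $\pi^*$ is optimal for CP, then $$x^* := e + \frac{c \cdot e - z}{c \cdot e - z^*}\,(\pi^* - e)$$ is optimal for $(\mathrm{P}_z)$, and $\pi^* = \pi(x^* )$.
   Context: $\mathcal{E}$ is a finite-dimensional real Euclidean space with inner product written $u \cdot v$, and $\mathcal{K} \subset \mathcal{E}$ is a proper (meaning $\mathcal{K} \neq \mathcal{E}$; not necessarily pointed) closed convex cone with nonempty interior $\mathrm{int}(\mathcal{K})$. $\mathrm{Affine} \subseteq \mathcal{E}$ is an affine space (a translate of a linear subspace), and $c \in \mathcal{E}$ is not orthogonal to the subspace of which $\mathrm{Affine}$ is a translate. The conic program CP is $$\inf\ c \cdot x \quad \text{s.t.} \quad x \in \mathrm{Affine},\ x \in \mathcal{K},$$ with optimal value $z^*$, assumed finite. The set $\mathrm{Affine} \cap \mathrm{int}(\mathcal{K})$ of strictly feasible points is assumed nonempty, and $e$ is a fixed point of it. For $z \in \mathbb{R}$, $\mathrm{Affine}_z := \{x \in \mathrm{Affine} : c \cdot x = z\}$. For $x \in \mathcal{E}$, $$\lambda_{\min}(x) := \inf\{\lambda \in \mathbb{R} : x - \lambda e \notin \mathcal{K}\},$$ i.e. the unique scalar $\lambda$ for which $x - \lambda e$ lies in the boundary of $\mathcal{K}$. For $x$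 with $\lambda_{\min}(x) < 1$, $$\pi(x) := e + \frac{1}{1-\lambda_{\min}(x)}(x-e),$$ the point where the half-line from $e$ in direction $x - e$ meets the boundary of $\mathcal{K}$. (When $z^*$ is finite, every $x \in \mathrm{Affine}$ with $c \cdot x < c \cdot e$ satisfies $\lambda_{\min}(x) < 1$, so $\pi(x)$ is defined.) *)

theory Defs
  imports "HOL-Analysis.Analysis"
begin

definition lambda_min :: "'a::euclidean_space set \<Rightarrow> 'a \<Rightarrow> 'a \<Rightarrow> real" where
  "lambda_min K e x = Inf {l. x - l *\<^sub>R e \<notin> K}"

(* The intended domain is lambda_min K e x < 1; see lambda_min_less_1 below. *)
definition bdry_proj :: "'a::euclidean_space set \<Rightarrow> 'a \<Rightarrow> 'a \<Rightarrow> 'a" where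
  "bdry_proj K e x = e + (1 / (1 - lambda_min K e x)) *\<^sub>R (x - e)"

definition slice :: "'a::euclidean_space set \<Rightarrow> 'a \<Rightarrow> real \<Rightarrow> 'a set" where
  "slice A c z = {x \<in> A. c \<bullet> x = z}"

(* Extended-real valued, so that "the optimal value is finite" is a genuine
   condition: Inf on type real would be a real number in every case. *)
definition cp_value :: "'a::euclidean_space set \<Rightarrow> 'a set \<Rightarrow> 'a \<Rightarrow> ereal" where
  "cp_value K A c = (INF x \<in> A \<inter> K. ereal (c \<bullet> x))"

definition cp_optimal :: "'a::euclidean_space set \<Rightarrow> 'a set \<Rightarrow> 'a \<Rightarrow> 'a \<Rightarrow> bool" where
  "cp_optimal K A c x \<longleftrightarrow> is_arg_min (\<lambda>y. c \<bullet> y) (\<lambda>y. y \<in> A \<inter> K) x"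

definition pz_optimal ::
  "'a::euclidean_space set \<Rightarrow> 'a set \<Rightarrow> 'a \<Rightarrow> 'a \<Rightarrow> real \<Rightarrow> 'a \<Rightarrow> bool" where
  "pz_optimal K A c e z x \<longleftrightarrow> is_arg_max (lambda_min K e) (\<lambda>y. y \<in> slice A c z) x"

(* The remaining lemmas show that the real-valued Inf in lambda_min is over a nonempty set
   bounded below, and that bdry_proj is only applied inside its intended domain. *)

lemma convex_cone_shift:
  fixes K :: "'a::euclidean_space set"
  assumes "convex_cone K" "x - l *\<^sub>R e \<in> K" "e \<in> K" "m \<le> l"
  shows "x - m *\<^sub>R e \<in> K"
proof -
  have "(l - m) *\<^sub>R e \<in> K"
    using assms by (auto simp: convex_cone_iff)
  then have "(x - l *\<^sub>R e) + (l - m) *\<^sub>R e \<in> K"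
    using assms by (auto simp: convex_cone_iff)
  then show ?thesis by (simp add: algebra_simps)
qed

lemma interior_absorbs:
  fixes K :: "'a::euclidean_space set"
  assumes "convex_cone K" "e \<in> interior K"
  obtains t where "t > 0" "x + t *\<^sub>R e \<in> K"
proof -
  obtain r where r: "r > 0" "cball e r \<subseteq> K"
    using assms(2) by (auto simp: mem_interior_cball)
  define s where "s = r / (norm x + 1)"
  have s: "s > 0" using r by (simp add: s_def add_nonneg_pos)
  have "s * norm x \<le> r"
    using r norm_ge_zero[of x] by (simp add: s_def divide_le_eq add_nonneg_pos distrib_left)
  then have "e + s *\<^sub>R x \<in> K"
    using r s by (intro subsetD[OF r(2)]) (simp add: dist_norm)
  then have "(1/s) *\<^sub>R (e + s *\<^sub>R x) \<in> K"
    using assms(1) s by (auto simp: convex_cone_iff)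
  then have "x + (1/s) *\<^sub>R e \<in> K"
    using s by (simp add: algebra_simps)
  then show thesis using s that[of "1/s"] by simp
qed

lemma lambda_min_set_bdd_below:
  fixes K :: "'a::euclidean_space set"
  assumes "convex_cone K" "e \<in> interior K"
  shows "bdd_below {l. x - l *\<^sub>R e \<notin> K}"
proof -
  obtain t where "x + t *\<^sub>R e \<in> K" using interior_absorbs[OF assms] by blast
  then have "x - (- t) *\<^sub>R e \<in> K" by simp
  moreover have "e \<in> K" using assms(2) interior_subset by blast
  ultimately have "- t \<le> l" if "x - l *\<^sub>R e \<notin> K" for l
    using convex_cone_shift[OF assms(1)] that by (metis linear)
  then show ?thesis by (auto simp: bdd_below_def)
qed

lemma lambda_min_set_nonempty:
  fixes K :: "'a::euclidean_space set"
  assumes "closed K" "convex_cone K" "K \<noteq> UNIV" "e \<in> interior K"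
  shows "{l. x - l *\<^sub>R e \<notin> K} \<noteq> {}"
proof
  assume "{l. x - l *\<^sub>R e \<notin> K} = {}"
  then have all: "x - l *\<^sub>R e \<in> K" for l by auto
  have "inverse (real (Suc n)) *\<^sub>R (x - real (Suc n) *\<^sub>R e) \<in> K" for n
    using all assms(2) unfolding convex_cone_iff
    by (metis inverse_nonnegative_iff_nonnegative of_nat_0_le_iff)
  then have mem: "inverse (real (Suc n)) *\<^sub>R x - e \<in> K" for n
    by (simp add: scaleR_diff_right del: of_nat_Suc)
  have "(\<lambda>n. inverse (real (Suc n)) *\<^sub>R x - e) \<longlonglongrightarrow> 0 *\<^sub>R x - e"
    by (intro tendsto_intros LIMSEQ_inverse_real_of_nat)
  then have neg: "- e \<in> K"
    using closed_sequentially[OF assms(1) mem] by simp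
  have "y \<in> K" for y
  proof -
    obtain t where t: "t > 0" "y + t *\<^sub>R e \<in> K"
      using interior_absorbs[OF assms(2,4)] by blast
    have "t *\<^sub>R (- e) \<in> K" using neg t assms(2) unfolding convex_cone_iff by auto
    then have "(y + t *\<^sub>R e) + t *\<^sub>R (- e) \<in> K"
      using t assms(2) unfolding convex_cone_iff by blast
    then show ?thesis by simp
  qed
  then show False using assms(3) by auto
qed

lemma lambda_min_less_1:
  fixes K :: "'a::euclidean_space set"
  assumes "closed K" "convex_cone K" "affine A"
    and "cp_value K A c = ereal zopt"
    and "e \<in> A \<inter> interior K" "x \<in> A" "c \<bullet> x < c \<bullet> e"
  shows "lambda_min K e x < 1"
proof (rule ccontr)
  assume ge: "\<not> lambda_min K e x < 1"
  have eK: "e \<in> K" using assms(5) interior_subset by blast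
  have "x - (1 - inverse (real (Suc n))) *\<^sub>R e \<in> K" for n
  proof (rule ccontr)
    assume "x - (1 - inverse (real (Suc n))) *\<^sub>R e \<notin> K"
    then have "lambda_min K e x \<le> 1 - inverse (real (Suc n))"
      unfolding lambda_min_def using lambda_min_set_bdd_below[of K e x] assms
      by (intro cInf_lower) auto
    moreover have "inverse (real (Suc n)) > 0" by simp
    ultimately show False using ge by linarith
  qed
  moreover have "(\<lambda>n. x - (1 - inverse (real (Suc n))) *\<^sub>R e) \<longlonglongrightarrow> x - (1 - 0) *\<^sub>R e"
    by (intro tendsto_intros LIMSEQ_inverse_real_of_nat)
  ultimately have dir: "x - e \<in> K"
    using closed_sequentially[OF assms(1)] by fastforce
  define t where "t = (\<bar>c \<bullet> e - zopt\<bar> + 1) / (c \<bullet> e - c \<bullet> x)"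
  have t: "t \<ge> 0" "t * (c \<bullet> e - c \<bullet> x) = \<bar>c \<bullet> e - zopt\<bar> + 1"
    using assms(7) by (auto simp: t_def)
  define y where "y = e + t *\<^sub>R (x - e)"
  have "t *\<^sub>R (x - e) \<in> K" using dir t(1) assms(2) unfolding convex_cone_iff by blast
  then have "y \<in> K" using eK assms(2) unfolding y_def convex_cone_iff by blast
  moreover have "y \<in> A"
  proof -
    have "(1 - t) *\<^sub>R e + t *\<^sub>R x \<in> A"
      using assms(3,5,6) by (auto simp: affine_def)
    then show ?thesis by (simp add: y_def algebra_simps)
  qed
  ultimately have "cp_value K A c \<le> ereal (c \<bullet> y)"
    unfolding cp_value_def by (intro INF_lower) auto
  then have "zopt \<le> c \<bullet> y" using assms(4) by simp
  also have "c \<bullet> y = c \<bullet> e - t * (c \<bullet> e - c \<bullet> x)"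
    by (simp add: y_def inner_simps algebra_simps)
  finally show False using t(2) by linarith
qed

end

theory Submission
  imports Defs
begin

text \<open>
  Both optimization problems are the same problem seen along the rays that leave \<open>e\<close>.  Put
  \<open>g x = 1 - lambda_min K e x\<close>.  As \<open>K\<close> is a closed cone, \<open>x - l e\<close> lies in \<open>K\<close> exactly when
  \<open>l \<le> lambda_min K e x\<close> (\<open>le_lambda_min_iff\<close>), and hence \<open>g\<close> is positively homogeneous about \<open>e\<close>:
  \<open>g (e + t (x - e)) = t g x\<close> for \<open>t > 0\<close> (\<open>lambda_min_along_ray\<close>).  The objective drop
  \<open>d x = c \<bullet> e - c \<bullet> x\<close> is homogeneous about \<open>e\<close> as well, so the ratio \<open>d / g\<close> is constant on each
  ray from \<open>e\<close>.

  The problem on the slice fixes the numerator \<open>d = c \<bullet> e - z\<close> and minimizes \<open>g\<close>.  The conic program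
  maximizes \<open>d\<close> under the constraint \<open>g \<le> 1\<close>, which is membership in \<open>K\<close>.  Both therefore maximize
  \<open>d / g\<close> over the rays from \<open>e\<close> on which the objective decreases: rescaling a point to \<open>d = c \<bullet> e - z\<close>
  gives the slice, and rescaling it to \<open>g = 1\<close> gives \<open>bdry_proj\<close>.  Such rays have \<open>g > 0\<close>, since
  otherwise the conic program would be unbounded, and they exist because \<open>e\<close> is interior and \<open>c\<close> is
  not constant on the affine space; this gives \<open>zopt < c \<bullet> e\<close> (\<open>cp_value_less_interior\<close>).
\<close>

text \<open>
  The set whose infimum defines \<open>lambda_min\<close> is upward closed because \<open>e \<in> K\<close>; closedness of \<open>K\<close>
  makes it open, so its infimum is not attained.
\<close>
lemma le_lambda_min_iff:
  fixes K :: "'a::euclidean_space set"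
  assumes "closed K" "convex_cone K" "K \<noteq> UNIV" "e \<in> interior K"
  shows "l \<le> lambda_min K e x \<longleftrightarrow> x - l *\<^sub>R e \<in> K"
proof
  assume le: "l \<le> lambda_min K e x"
  have "x - (l - inverse (real (Suc n))) *\<^sub>R e \<in> K" for n
  proof (rule ccontr)
    assume "x - (l - inverse (real (Suc n))) *\<^sub>R e \<notin> K"
    then have "lambda_min K e x \<le> l - inverse (real (Suc n))"
      unfolding lambda_min_def using lambda_min_set_bdd_below[OF assms(2,4)]
      by (intro cInf_lower) auto
    moreover have "inverse (real (Suc n)) > 0" by simp
    ultimately show False using le by linarith
  qed
  moreover have "(\<lambda>n. x - (l - inverse (real (Suc n))) *\<^sub>R e) \<longlonglongrightarrow> x - (l - 0) *\<^sub>R e"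
    by (intro tendsto_intros LIMSEQ_inverse_real_of_nat)
  ultimately show "x - l *\<^sub>R e \<in> K"
    using closed_sequentially[OF assms(1)] by fastforce
next
  have eK: "e \<in> K" using assms(4) interior_subset by blast
  assume "x - l *\<^sub>R e \<in> K"
  then have "l \<le> m" if "x - m *\<^sub>R e \<notin> K" for m
    using convex_cone_shift[OF assms(2) _ eK] that by (metis linear)
  then show "l \<le> lambda_min K e x"
    unfolding lambda_min_def using lambda_min_set_nonempty[OF assms]
    by (intro cInf_greatest) auto
qed

lemma mem_cone_iff_lambda_min_nonneg:
  fixes K :: "'a::euclidean_space set"
  assumes "closed K" "convex_cone K" "K \<noteq> UNIV" "e \<in> interior K"
  shows "x \<in> K \<longleftrightarrow> 0 \<le> lambda_min K e x"
  using le_lambda_min_iff[OF assms, of 0 x] by simp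

lemma convex_cone_scaleR_iff:
  assumes "convex_cone K" "t > 0"
  shows "t *\<^sub>R x \<in> K \<longleftrightarrow> x \<in> K"
proof
  assume "t *\<^sub>R x \<in> K"
  then have "inverse t *\<^sub>R (t *\<^sub>R x) \<in> K"
    using assms unfolding convex_cone_iff by (meson inverse_nonnegative_iff_nonnegative less_imp_le)
  then show "x \<in> K" using assms(2) by simp
qed (use assms in \<open>auto simp: convex_cone_iff\<close>)

text \<open>
  Subtracting \<open>l e\<close> from the point at parameter \<open>t\<close> of the ray gives \<open>t\<close> times the point
  \<open>x - (1 - (1 - l) / t) e\<close>, and membership in a cone ignores the factor \<open>t\<close>.
\<close>
lemma lambda_min_along_ray:
  fixes K :: "'a::euclidean_space set"
  assumes "closed K" "convex_cone K" "K \<noteq> UNIV" "e \<in> interior K" "t > 0"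
  shows "1 - lambda_min K e (e + t *\<^sub>R (x - e)) = t * (1 - lambda_min K e x)"
proof -
  have iff: "l \<le> lambda_min K e (e + t *\<^sub>R (x - e)) \<longleftrightarrow> l \<le> 1 - t * (1 - lambda_min K e x)" for l
  proof -
    define m where "m = 1 - (1 - l) / t"
    have tm: "t * m = t - (1 - l)"
      using assms(5) by (simp add: m_def field_simps)
    have "e + t *\<^sub>R (x - e) - l *\<^sub>R e = t *\<^sub>R x - (t - (1 - l)) *\<^sub>R e"
      by (simp add: algebra_simps)
    also have "\<dots> = t *\<^sub>R (x - m *\<^sub>R e)"
      by (simp add: scaleR_diff_right tm)
    finally have "l \<le> lambda_min K e (e + t *\<^sub>R (x - e)) \<longleftrightarrow> m \<le> lambda_min K e x"
      using le_lambda_min_iff[OF assms(1-4)] convex_cone_scaleR_iff[OF assms(2,5)] by metis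
    also have "\<dots> \<longleftrightarrow> t * m \<le> t * lambda_min K e x"
      using assms(5) by simp
    also have "\<dots> \<longleftrightarrow> l \<le> 1 - t * (1 - lambda_min K e x)"
      unfolding tm right_diff_distrib by auto
    finally show ?thesis .
  qed
  have "lambda_min K e (e + t *\<^sub>R (x - e)) = 1 - t * (1 - lambda_min K e x)"
    using iff order_refl by (metis order_antisym)
  then show ?thesis by simp
qed

lemma affine_ray:
  assumes "affine A" "e \<in> A" "x \<in> A"
  shows "e + t *\<^sub>R (x - e) \<in> A"
proof -
  have "(1 - t) *\<^sub>R e + t *\<^sub>R x \<in> A"
    using assms by (auto simp: affine_def)
  then show ?thesis by (simp add: algebra_simps)
qed

lemma inner_ray:
  "c \<bullet> e - c \<bullet> (e + t *\<^sub>R (x - e)) = t * (c \<bullet> e - c \<bullet> x)"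
  by (simp add: inner_simps algebra_simps)

lemma bdry_proj_in_cone:
  fixes K :: "'a::euclidean_space set"
  assumes "closed K" "convex_cone K" "K \<noteq> UNIV" "e \<in> interior K" "lambda_min K e x < 1"
  shows "bdry_proj K e x \<in> K"
proof -
  have "1 - lambda_min K e (bdry_proj K e x) = 1"
    unfolding bdry_proj_def using assms by (subst lambda_min_along_ray) auto
  then show ?thesis using mem_cone_iff_lambda_min_nonneg[OF assms(1-4)] by simp
qed

lemma cp_value_le:
  assumes "cp_value K A c = ereal zopt" "y \<in> A" "y \<in> K"
  shows "zopt \<le> c \<bullet> y"
proof -
  have "cp_value K A c \<le> ereal (c \<bullet> y)"
    unfolding cp_value_def using assms by (intro INF_lower) auto
  then show ?thesis using assms(1) by simp
qed

lemma cp_optimal_iff: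
  "cp_optimal K A c p \<longleftrightarrow> p \<in> A \<and> p \<in> K \<and> (\<forall>y\<in>A \<inter> K. c \<bullet> p \<le> c \<bullet> y)"
  by (auto simp: cp_optimal_def is_arg_min_linorder)

lemma pz_optimal_iff:
  "pz_optimal K A c e z x \<longleftrightarrow>
     x \<in> slice A c z \<and> (\<forall>y\<in>slice A c z. lambda_min K e y \<le> lambda_min K e x)"
  by (auto simp: pz_optimal_def is_arg_max_linorder)

lemma cp_optimal_value:
  assumes "cp_value K A c = ereal zopt" "cp_optimal K A c p"
  shows "c \<bullet> p = zopt"
proof -
  have "ereal (c \<bullet> p) \<le> cp_value K A c"
    unfolding cp_value_def using assms(2) by (intro INF_greatest) (auto simp: cp_optimal_iff)
  moreover have "zopt \<le> c \<bullet> p"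
    using cp_value_le[OF assms(1)] assms(2) by (auto simp: cp_optimal_iff)
  ultimately show ?thesis using assms(1) by simp
qed

text \<open>
  A point of \<open>A\<close> interior to \<open>K\<close> cannot be optimal when \<open>c\<close> is not constant on \<open>A\<close>: a short step
  along a decreasing direction of \<open>A\<close> stays feasible.
\<close>
lemma cp_value_less_interior:
  fixes K :: "'a::euclidean_space set"
  assumes "affine_parallel L A" "subspace L" "\<exists>v\<in>L. \<not> orthogonal c v"
    and "cp_value K A c = ereal zopt" "e \<in> A" "e \<in> interior K"
  shows "zopt < c \<bullet> e"
proof -
  obtain v0 where v0: "v0 \<in> L" "c \<bullet> v0 \<noteq> 0"
    using assms(3) by (auto simp: orthogonal_def)
  define v where "v = (if c \<bullet> v0 < 0 then v0 else - v0)"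
  have v: "v \<in> L" "c \<bullet> v < 0"
    using v0 assms(2) by (auto simp: v_def subspace_neg)
  then have vn: "norm v > 0" by auto
  obtain r where r: "r > 0" "cball e r \<subseteq> K"
    using assms(6) by (auto simp: mem_interior_cball)
  define s where "s = r / norm v"
  have s: "s > 0" using r vn by (simp add: s_def)
  have inK: "e + s *\<^sub>R v \<in> K"
    using r vn by (intro subsetD[OF r(2)]) (simp add: dist_norm s_def)
  obtain a where a: "A = (\<lambda>x. a + x) ` L"
    using assms(1) by (auto simp: affine_parallel_def)
  then obtain w where w: "w \<in> L" "e = a + w" using assms(5) by auto
  have "w + s *\<^sub>R v \<in> L"
    using w v assms(2) by (intro subspace_add subspace_scale)
  then have "e + s *\<^sub>R v \<in> A"
    using a w by (auto simp: add.assoc)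
  then have "zopt \<le> c \<bullet> (e + s *\<^sub>R v)"
    using cp_value_le[OF assms(4)] inK by blast
  moreover have "s * (c \<bullet> v) < 0" using s v by (simp add: mult_pos_neg)
  ultimately show ?thesis by (simp add: inner_simps)
qed

theorem theorem2p3:
  fixes K :: "'a::euclidean_space set"
    and Aff L :: "'a set"
    and c e :: 'a
    and zopt z :: real
  assumes "closed K" and "convex_cone K" and "K \<noteq> UNIV" and "interior K \<noteq> {}"
    and "affine Aff" and "subspace L" and "affine_parallel L Aff"
    and "\<exists>v\<in>L. \<not> orthogonal c v"
    and "cp_value K Aff c = ereal zopt"
    and "e \<in> Aff \<inter> interior K"
    and "z < c \<bullet> e"
  shows "(\<forall>xopt. pz_optimal K Aff c e z xopt \<longrightarrow> cp_optimal K Aff c (bdry_proj K e xopt))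
    \<and> (\<forall>popt. cp_optimal K Aff c popt \<longrightarrow>
          (let xopt = e + ((c \<bullet> e - z) / (c \<bullet> e - zopt)) *\<^sub>R (popt - e)
           in pz_optimal K Aff c e z xopt \<and> popt = bdry_proj K e xopt))"
proof (intro conjI allI impI)
  note K = assms(1-3)
  have eA: "e \<in> Aff" and eI: "e \<in> interior K"
    using assms(10) by auto
  note lt1 = lambda_min_less_1[OF assms(1,2,5,9,10)]
  note ray = lambda_min_along_ray[OF K eI]
  have zlt: "zopt < c \<bullet> e"
    using cp_value_less_interior[OF assms(7,6,8,9) eA eI] .
  \<comment> \<open>With \<open>g\<close> the distance of \<open>lambda_min\<close> below 1: rescaling a slice point to \<open>g = 1\<close> divides its
    objective drop \<open>c \<bullet> e - z\<close> by \<open>g\<close>, so small \<open>g\<close> means a good feasible point.\<close>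
  have to_cone: "bdry_proj K e x \<in> Aff \<inter> K" "lambda_min K e x < 1"
      "(1 - lambda_min K e x) * (c \<bullet> e - c \<bullet> bdry_proj K e x) = c \<bullet> e - z"
    if x: "x \<in> slice Aff c z" for x
  proof -
    have xA: "x \<in> Aff" and cx: "c \<bullet> x = z" using x by (auto simp: slice_def)
    show l: "lambda_min K e x < 1" using lt1 xA cx assms(11) by simp
    show "bdry_proj K e x \<in> Aff \<inter> K"
      using bdry_proj_in_cone[OF K eI l] affine_ray[OF assms(5) eA xA]
      by (simp add: bdry_proj_def)
    show "(1 - lambda_min K e x) * (c \<bullet> e - c \<bullet> bdry_proj K e x) = c \<bullet> e - z"
      unfolding bdry_proj_def inner_ray using l cx by simp
  qed
  \<comment> \<open>A feasible point has \<open>g \<le> 1\<close>; the factor that brings its objective drop to \<open>c \<bullet> e - z\<close>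
    therefore bounds the new \<open>g\<close>.\<close>
  have to_slice: "e + ((c \<bullet> e - z) / (c \<bullet> e - c \<bullet> y)) *\<^sub>R (y - e) \<in> slice Aff c z"
      "1 - lambda_min K e (e + ((c \<bullet> e - z) / (c \<bullet> e - c \<bullet> y)) *\<^sub>R (y - e))
         \<le> (c \<bullet> e - z) / (c \<bullet> e - c \<bullet> y)"
    if y: "y \<in> Aff \<inter> K" "c \<bullet> y < c \<bullet> e" for y
  proof -
    define t where "t = (c \<bullet> e - z) / (c \<bullet> e - c \<bullet> y)"
    have t: "t > 0" using y assms(11) by (simp add: t_def)
    have "t * (c \<bullet> e - c \<bullet> y) = c \<bullet> e - z" using y by (simp add: t_def)
    then have "c \<bullet> (e + t *\<^sub>R (y - e)) = z" using inner_ray[of c e t y] by simp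
    then show "e + ((c \<bullet> e - z) / (c \<bullet> e - c \<bullet> y)) *\<^sub>R (y - e) \<in> slice Aff c z"
      using affine_ray[OF assms(5) eA, of y t] y by (simp add: slice_def t_def)
    have "0 \<le> lambda_min K e y"
      using mem_cone_iff_lambda_min_nonneg[OF K eI] y by blast
    then have "t * (1 - lambda_min K e y) \<le> t * 1"
      using t by (intro mult_left_mono) auto
    then show "1 - lambda_min K e (e + ((c \<bullet> e - z) / (c \<bullet> e - c \<bullet> y)) *\<^sub>R (y - e))
         \<le> (c \<bullet> e - z) / (c \<bullet> e - c \<bullet> y)"
      using ray[OF t, of y] by (simp add: t_def)
  qed
  {
    fix xopt assume opt: "pz_optimal K Aff c e z xopt"
    then have xs: "xopt \<in> slice Aff c z"
      and xmax: "\<And>y. y \<in> slice Aff c z \<Longrightarrow> lambda_min K e y \<le> lambda_min K e xopt"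
      by (auto simp: pz_optimal_iff)
    define g where "g = 1 - lambda_min K e xopt"
    have g: "g > 0" "g * (c \<bullet> e - c \<bullet> bdry_proj K e xopt) = c \<bullet> e - z"
      using to_cone[OF xs] by (auto simp: g_def)
    have "g * (c \<bullet> e - c \<bullet> bdry_proj K e xopt) > 0" using g(2) assms(11) by simp
    then have pe: "c \<bullet> bdry_proj K e xopt < c \<bullet> e" using g(1) by (simp add: zero_less_mult_iff)
    have "c \<bullet> bdry_proj K e xopt \<le> c \<bullet> y" if y: "y \<in> Aff \<inter> K" for y
    proof (cases "c \<bullet> y < c \<bullet> e")
      case True
      have "g \<le> (c \<bullet> e - z) / (c \<bullet> e - c \<bullet> y)"
        using xmax[OF to_slice(1)[OF y True]] to_slice(2)[OF y True] by (simp add: g_def)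
      then have "g * (c \<bullet> e - c \<bullet> y) \<le> g * (c \<bullet> e - c \<bullet> bdry_proj K e xopt)"
        using True g(2) by (simp add: pos_le_divide_eq)
      then show ?thesis using g(1) by simp
    qed (use pe in simp)
    then show "cp_optimal K Aff c (bdry_proj K e xopt)"
      using to_cone(1)[OF xs] by (simp add: cp_optimal_iff)
  next
    fix popt assume opt: "cp_optimal K Aff c popt"
    then have p: "popt \<in> Aff \<inter> K" by (simp add: cp_optimal_iff)
    have cp: "c \<bullet> popt = zopt" using cp_optimal_value[OF assms(9) opt] .
    define t where "t = (c \<bullet> e - z) / (c \<bullet> e - zopt)"
    define xopt where "xopt = e + t *\<^sub>R (popt - e)"
    have t: "t > 0" using zlt assms(11) by (simp add: t_def)
    have xs: "xopt \<in> slice Aff c z" and xle: "1 - lambda_min K e xopt \<le> t"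
      using to_slice[OF p] cp zlt by (auto simp: xopt_def t_def)
    \<comment> \<open>No slice point beats \<open>t\<close>, since its boundary projection would have a value below \<open>zopt\<close>.
      Applied to \<open>xopt\<close> itself, this also turns \<open>xle\<close> into an equality, which is why rescaling by
      \<open>bdry_proj\<close> undoes the factor \<open>t\<close> exactly.\<close>
    have lower: "t \<le> 1 - lambda_min K e y" if y: "y \<in> slice Aff c z" for y
    proof -
      have "zopt \<le> c \<bullet> bdry_proj K e y"
        using cp_value_le[OF assms(9)] to_cone(1)[OF y] by blast
      then have "(1 - lambda_min K e y) * (c \<bullet> e - c \<bullet> bdry_proj K e y)
          \<le> (1 - lambda_min K e y) * (c \<bullet> e - zopt)"
        using to_cone(2)[OF y] by (intro mult_left_mono) auto
      then show ?thesis using to_cone(3)[OF y] zlt by (simp add: t_def pos_divide_le_eq)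
    qed
    have "pz_optimal K Aff c e z xopt"
      using xs xle lower by (force simp: pz_optimal_iff)
    moreover have "1 - lambda_min K e xopt = t"
      using xle lower[OF xs] by simp
    then have "popt = bdry_proj K e xopt"
      using t by (simp add: bdry_proj_def xopt_def)
    ultimately show "let xopt = e + ((c \<bullet> e - z) / (c \<bullet> e - zopt)) *\<^sub>R (popt - e)
           in pz_optimal K Aff c e z xopt \<and> popt = bdry_proj K e xopt"
      unfolding Let_def xopt_def t_def by (rule conjI)
  }
qed

end
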